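(* For $n\ge 2$, the entropy-based inconsistency index $I_H$ on the set $\mathcal A$ of pairwise comparison matrices of order $n$ satisfies the following properties. (P1, null inconsistency) For $\mathbf A\in\mathcal A$: $I_H(\mathbf A)=0$ if and only if $\mathbf A\in\mathcal A^*$. (P2, permutation invariance) $I_H(\mathbf P\mathbf A\mathbf P^\top)=I_H(\mathbf A)$ for every $\mathbf A\in\mathcal A$ and every permutation matrix $\mathbf P$. (P3, monotonicity under power transformation) For every $\mathbf A\in\mathcal A$, writing $\mathbf A^b=(a_{ij}^b)$ for the entrywise power, $b_2>b_1>0$ implies $I_H(\mathbf A^{b_2})\ge I_H(\mathbf A^{b_1})$. (P4, monotonicity on single comparisons) Let $n\ge3$, $\mathbf A\in\mathcal A^*$ and $p\ne q$. For $\delta>0$ let $\mathbf A^{pq}(\delta)$ be obtained from $\mathbf A$ by replacing $a_{pq}$ with $\delta a_{pq}$ and $a_{qp}$ with $\delta^{-1}a_{qp}$, leaving all other entries unchanged. Then the function $\delta\mapsto I_H(\mathbf A^{pq}(\delta))$ is quasi-convex on $\mathbb R_{>0}$ and has its unique global minimum at $\delta=1$. (P5, continuity) $I_H(\mathbf A)$ is a continuous function of the entries of $\mathbf A\in\mathcal A$. (P6, transposition invariance) $I_H(\mathbf A^\top)=I_H(\mathbf A)$ for every $\mathbf A\in\mathcal A$. (P7, invariance under diagonal similarity) For every $\mathbf A\in\mathcal A$ and every diagonal matrix $\mathbf D=\operatorname{diag}(d_1,\ldots,d_n)$ with $d_i>0$ for all $i$, $I_H(\mathbf D\mathbf A\mathbf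 D^{-1})=I_H(\mathbf A)$.
   Context: $\mathcal A$ is the set of pairwise comparison matrices: real $n\times n$ matrices $\mathbf A=(a_{ij})$ with positive entries such that $a_{ii}=1$ for all $i$ and $a_{ij}=1/a_{ji}$ for all $i,j$. $\mathbf A\in\mathcal A$ is consistent if there is a vector $\mathbf w$ with positive components such that $a_{ij}=w_i/w_j$ for all $i,j$; $\mathcal A^*\subset\mathcal A$ is the set of consistent matrices. Sinkhorn scaling: by Sinkhorn's theorem, for every $n\times n$ matrix $\mathbf A$ with positive entries there exist diagonal matrices $\mathbf D_1,\mathbf D_2$ with strictly positive diagonal entries such that $\mathbf S=\mathbf D_1\mathbf A\mathbf D_2$ is doubly stochastic (nonnegative entries, all row and column sums equal to $1$). The matrix $\mathbf S=\mathbf S(\mathbf A)=(s_{ij})$ is unique. Entropy-based inconsistency index: for $\mathbf A\in\mathcal A$ with $\mathbf S=\mathbf S(\mathbf A)$, $$I_H(\mathbf A)=1-\frac{H(\mathbf S)}{n\log_2 n},\qquad H(\mathbf S)=-\sum_{i=1}^n\sum_{j=1}^n s_{ij}\log_2 s_{ij}.$$ *)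

theory Defs
  imports "HOL-Analysis.Analysis"
begin

definition pcms :: "(real ^ 'n ^ 'n) set" where
  "pcms = {A. (\<forall>i j. A $ i $ j > 0) \<and> (\<forall>i. A $ i $ i = 1) \<and> (\<forall>i j. A $ i $ j = 1 / A $ j $ i)}"

definition consistent_pcms :: "(real ^ 'n ^ 'n) set" where
  "consistent_pcms =
     {A \<in> pcms. \<exists>w :: real ^ 'n. (\<forall>i. w $ i > 0) \<and> (\<forall>i j. A $ i $ j = w $ i / w $ j)}"

definition diag_mat :: "real ^ 'n \<Rightarrow> real ^ 'n ^ 'n" where
  "diag_mat d = (\<chi> i j. if i = j then d $ i else 0)"

definition permutation_matrix :: "real ^ 'n ^ 'n \<Rightarrow> bool" where
  "permutation_matrix P \<longleftrightarrow>
     (\<exists>\<sigma>. \<sigma> permutes UNIV \<and> P = (\<chi> i j. if j = \<sigma> i then 1 else 0))"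

definition doubly_stochastic :: "real ^ 'n ^ 'n \<Rightarrow> bool" where
  "doubly_stochastic S \<longleftrightarrow>
     (\<forall>i j. S $ i $ j \<ge> 0) \<and> (\<forall>i. (\<Sum>j\<in>UNIV. S $ i $ j) = 1) \<and> (\<forall>j. (\<Sum>i\<in>UNIV. S $ i $ j) = 1)"

text \<open>For a matrix with positive entries, the description below has exactly one solution by
  Sinkhorn's theorem; for other matrices the value is not specified.\<close>

definition sinkhorn :: "real ^ 'n ^ 'n \<Rightarrow> real ^ 'n ^ 'n" where
  "sinkhorn A =
     (THE S. doubly_stochastic S \<and>
        (\<exists>d1 d2. (\<forall>i. d1 $ i > 0) \<and> (\<forall>i. d2 $ i > 0) \<and> S = diag_mat d1 ** A ** diag_mat d2))"

definition mat_entropy :: "real ^ 'n ^ 'n \<Rightarrow> real" where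
  "mat_entropy S = - (\<Sum>i\<in>UNIV. \<Sum>j\<in>UNIV. S $ i $ j * log 2 (S $ i $ j))"

definition I_H :: "real ^ 'n ^ 'n \<Rightarrow> real" where
  "I_H A = 1 - mat_entropy (sinkhorn A) / (real CARD('n) * log 2 (real CARD('n)))"

definition entrywise_powr :: "real ^ 'n ^ 'n \<Rightarrow> real \<Rightarrow> real ^ 'n ^ 'n" where
  "entrywise_powr A b = (\<chi> i j. (A $ i $ j) powr b)"

definition perturb :: "real ^ 'n ^ 'n \<Rightarrow> 'n \<Rightarrow> 'n \<Rightarrow> real \<Rightarrow> real ^ 'n ^ 'n" where
  "perturb A p q \<delta> =
     (\<chi> i j. if i = p \<and> j = q then \<delta> * A $ p $ q
            else if i = q \<and> j = p then inverse \<delta> * A $ q $ p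
            else A $ i $ j)"

definition quasi_convex_on :: "'a::real_vector set \<Rightarrow> ('a \<Rightarrow> real) \<Rightarrow> bool" where
  "quasi_convex_on S f \<longleftrightarrow> convex S \<and>
     (\<forall>x\<in>S. \<forall>y\<in>S. \<forall>u\<ge>0. \<forall>v\<ge>0. u + v = 1 \<longrightarrow> f (u *\<^sub>R x + v *\<^sub>R y) \<le> max (f x) (f y))"

end

theory Submission
  imports Defs
begin

text \<open>If \<open>S\<close> and \<open>T\<close> are Sinkhorn scalings of \<open>A\<close> and \<open>B\<close>, then \<open>log S\<close> and \<open>log A\<close> differ by
  a matrix of the form \<open>x i + y j\<close>, which is orthogonal to differences of doubly stochastic
  matrices. Hence \<open>(T - S) \<bullet> (log T - log S) = (T - S) \<bullet> (log B - log A)\<close>, and since \<open>ln\<close> has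
  slope at least 1 on \<open>(0, 1]\<close>, \<open>\<parallel>T - S\<parallel> \<le> \<parallel>log B - log A\<parallel>\<close>. This gives uniqueness of the
  scaling and continuity of the index (P5); the invariances (P2, P6, P7) follow from uniqueness.

  The same orthogonality combined with Gibbs' inequality shows that along \<open>b * log A\<close> both
  \<open>S \<bullet> log A\<close> and the negative entropy increase with \<open>b > 0\<close> (P3), and the equality case against
  the uniform matrix gives (P1). By diagonal similarity, (P4) reduces to perturbing the all-ones
  matrix; for \<open>\<delta> > 1\<close> the perturbed matrices are entrywise powers of each other, and \<open>\<delta>\<close> and
  \<open>1 / \<delta>\<close> are exchanged by transposition.\<close>

section \<open>Positive matrices and Sinkhorn scalings\<close>

definition pos_mat :: "real ^ 'n ^ 'm \<Rightarrow> bool" where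
  "pos_mat A \<longleftrightarrow> (\<forall>i j. A $ i $ j > 0)"

definition log_mat :: "real ^ 'n ^ 'm \<Rightarrow> real ^ 'n ^ 'm" where
  "log_mat A = (\<chi> i j. ln (A $ i $ j))"

text \<open>The predicate under the description operator in \<open>sinkhorn\<close>, named so that
  existence and uniqueness of a scaling can be treated separately.\<close>

definition sinkhorn_scaling :: "real ^ 'n ^ 'n \<Rightarrow> real ^ 'n ^ 'n \<Rightarrow> bool" where
  "sinkhorn_scaling A S \<longleftrightarrow> doubly_stochastic S \<and>
     (\<exists>d e. (\<forall>i. d $ i > 0) \<and> (\<forall>i. e $ i > 0) \<and> S = diag_mat d ** A ** diag_mat e)"

lemma diag_mat_mult_nth:
  fixes A :: "real ^ 'n ^ 'n"
  shows "(diag_mat d ** A ** diag_mat e) $ i $ j = d $ i * A $ i $ j * e $ j"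
  by (simp add: matrix_matrix_mult_def diag_mat_def if_distrib if_distribR cong: if_cong)

lemma sinkhorn_scalingI:
  fixes A S :: "real ^ 'n ^ 'n"
  assumes "doubly_stochastic S" "\<And>i. d i > 0" "\<And>j. e j > 0"
    and "\<And>i j. S $ i $ j = d i * A $ i $ j * e j"
  shows "sinkhorn_scaling A S"
proof -
  have "S = diag_mat (\<chi> i. d i) ** A ** diag_mat (\<chi> j. e j)"
    by (simp add: vec_eq_iff diag_mat_mult_nth assms(4))
  then show ?thesis
    unfolding sinkhorn_scaling_def using assms(1-3) by (metis vec_lambda_beta)
qed

lemma sinkhorn_scalingD:
  fixes A S :: "real ^ 'n ^ 'n"
  assumes "sinkhorn_scaling A S"
  shows "\<exists>d e. (\<forall>i. d i > 0) \<and> (\<forall>j. e j > 0) \<and> (\<forall>i j. S $ i $ j = d i * A $ i $ j * e j)"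
  using assms unfolding sinkhorn_scaling_def by (metis diag_mat_mult_nth)

lemma sinkhorn_scaling_doubly_stochastic:
  "sinkhorn_scaling A S \<Longrightarrow> doubly_stochastic S"
  by (simp add: sinkhorn_scaling_def)

lemma sinkhorn_scaling_pos_mat:
  assumes "pos_mat A" "sinkhorn_scaling A S"
  shows "pos_mat S"
  using assms(1) sinkhorn_scalingD[OF assms(2)] by (auto simp: pos_mat_def)

lemma inner_mat: "(A :: real ^ 'n ^ 'm) \<bullet> B = (\<Sum>i\<in>UNIV. \<Sum>j\<in>UNIV. A $ i $ j * B $ i $ j)"
  by (simp add: inner_vec_def)

lemma doubly_stochastic_le_1:
  assumes "doubly_stochastic S"
  shows "S $ i $ j \<le> 1"
proof -
  have "S $ i $ j \<le> (\<Sum>j\<in>UNIV. S $ i $ j)"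
    using assms by (intro member_le_sum) (auto simp: doubly_stochastic_def)
  then show ?thesis using assms by (simp add: doubly_stochastic_def)
qed

lemma doubly_stochastic_sum:
  fixes S :: "real ^ 'n ^ 'n"
  shows "doubly_stochastic S \<Longrightarrow> (\<Sum>i\<in>UNIV. \<Sum>j\<in>UNIV. S $ i $ j) = real CARD('n)"
  by (simp add: doubly_stochastic_def)

section \<open>Orthogonality and the Lipschitz estimate\<close>

text \<open>Row and column sums of \<open>T - T'\<close> vanish, so the terms
  \<open>ln (d i)\<close> and \<open>ln (e j)\<close> drop out. Both \<open>T\<close> and
  \<open>T'\<close> are arbitrary, so one difference can be tested against the scalings of two
  matrices.\<close>

lemma doubly_stochastic_diff_inner_log:
  fixes A S T T' :: "real ^ 'n ^ 'n"
  assumes A: "pos_mat A" and S: "sinkhorn_scaling A S"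
    and T: "doubly_stochastic T" "doubly_stochastic T'"
  shows "(T - T') \<bullet> log_mat S = (T - T') \<bullet> log_mat A"
proof -
  obtain d e where de: "\<And>i. d i > 0" "\<And>j. e j > 0"
    "\<And>i j. S $ i $ j = d i * A $ i $ j * e j"
    using sinkhorn_scalingD[OF S] by blast
  have log: "log_mat S $ i $ j = ln (d i) + log_mat A $ i $ j + ln (e j)" for i j
    using de A by (simp add: log_mat_def pos_mat_def ln_mult_pos)
  let ?U = "T - T'"
  have rows: "(\<Sum>j\<in>UNIV. ?U $ i $ j) = 0" for i
    using T by (simp add: doubly_stochastic_def sum_subtractf)
  have cols: "(\<Sum>i\<in>UNIV. ?U $ i $ j) = 0" for j
    using T by (simp add: doubly_stochastic_def sum_subtractf)
  have "?U \<bullet> log_mat S = (\<Sum>i\<in>UNIV. ln (d i) * (\<Sum>j\<in>UNIV. ?U $ i $ j)) + ?U \<bullet> log_mat A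
      + (\<Sum>i\<in>UNIV. \<Sum>j\<in>UNIV. ln (e j) * ?U $ i $ j)"
    unfolding inner_mat log sum_distrib_left sum.distrib[symmetric]
    by (intro sum.cong refl) (simp add: algebra_simps)
  also have "(\<Sum>i\<in>UNIV. \<Sum>j\<in>UNIV. ln (e j) * ?U $ i $ j)
      = (\<Sum>j\<in>UNIV. ln (e j) * (\<Sum>i\<in>UNIV. ?U $ i $ j))"
    unfolding sum_distrib_left by (rule sum.swap)
  finally show ?thesis
    unfolding rows cols by simp
qed

text \<open>The slope of \<open>ln\<close> is at least 1 on the unit interval. For
  \<open>s \<le> t\<close> this comes from \<open>ln (s / t) \<le> s / t - 1\<close> and
  \<open>t \<le> 1\<close>; the claim is symmetric in \<open>s\<close> and \<open>t\<close>.\<close>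

lemma diff_sq_le_diff_mult_ln_diff:
  fixes s t :: real
  assumes "0 < s" "s \<le> 1" "0 < t" "t \<le> 1"
  shows "(t - s)\<^sup>2 \<le> (t - s) * (ln t - ln s)"
  using assms
proof (induction s t rule: linorder_wlog)
  case (le s t)
  have "ln (s / t) \<le> s / t - 1"
    using le by (intro ln_le_minus_one) auto
  moreover have "(t - s) / t \<ge> t - s"
    using le by (simp add: pos_le_divide_eq mult_left_le)
  ultimately have "t - s \<le> ln t - ln s"
    using le by (simp add: ln_div diff_divide_distrib)
  then show ?case
    using le by (simp add: power2_eq_square mult_left_mono)
next
  case (sym s t)
  then show ?case by (simp add: power2_eq_square algebra_simps)
qed

text \<open>The case \<open>A = B\<close> gives uniqueness of the scaling; letting \<open>B\<close>
  tend to \<open>A\<close> gives its continuity.\<close>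

lemma sinkhorn_scaling_dist_le:
  fixes A B S T :: "real ^ 'n ^ 'n"
  assumes A: "pos_mat A" "sinkhorn_scaling A S" and B: "pos_mat B" "sinkhorn_scaling B T"
  shows "norm (T - S) \<le> norm (log_mat B - log_mat A)"
proof -
  have ds: "doubly_stochastic S" "doubly_stochastic T"
    using A B by (auto intro: sinkhorn_scaling_doubly_stochastic)
  have pos: "S $ i $ j > 0" "T $ i $ j > 0" for i j
    using sinkhorn_scaling_pos_mat A B unfolding pos_mat_def by blast+
  have "(norm (T - S))\<^sup>2 = (T - S) \<bullet> (T - S)"
    by (simp add: power2_norm_eq_inner)
  also have "\<dots> \<le> (T - S) \<bullet> (log_mat T - log_mat S)"
    unfolding inner_mat
  proof (intro sum_mono)
    fix i j
    show "(T - S) $ i $ j * (T - S) $ i $ j \<le> (T - S) $ i $ j * (log_mat T - log_mat S) $ i $ j"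
      using diff_sq_le_diff_mult_ln_diff[of "S $ i $ j" "T $ i $ j"] pos
        doubly_stochastic_le_1[OF ds(1)] doubly_stochastic_le_1[OF ds(2)]
      by (simp add: log_mat_def power2_eq_square)
  qed
  also have "\<dots> = (T - S) \<bullet> (log_mat B - log_mat A)"
    using doubly_stochastic_diff_inner_log[OF A ds(2,1)]
      doubly_stochastic_diff_inner_log[OF B ds(2,1)]
    by (simp add: inner_diff_right)
  also have "\<dots> \<le> norm (T - S) * norm (log_mat B - log_mat A)"
    by (rule norm_cauchy_schwarz)
  finally show ?thesis
    by (cases "T = S") (auto simp: power2_eq_square)
qed

section \<open>Existence and uniqueness of the scaling\<close>

lemma sinkhorn_scaling_exists:
  fixes A :: "real ^ 'n ^ 'n"
  assumes A: "pos_mat A"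
  shows "\<exists>S. sinkhorn_scaling A S"
proof -
  \<comment> \<open>A maximiser \<open>v\<close> of \<open>G\<close> is the left scaling and \<open>1 / c v\<close> the right one. As \<open>G\<close> is homogeneous
    of degree 0, a maximum over the compact simplex \<open>K\<close> is one over the positive orthant, and it
    avoids the boundary because \<open>G\<close> vanishes there.\<close>
  define c where "c v j = (\<Sum>i\<in>UNIV. A $ i $ j * v $ i)" for v :: "real ^ 'n" and j
  define G where "G v = (\<Prod>i\<in>UNIV. v $ i) / (\<Prod>j\<in>UNIV. c v j)" for v
  define K where "K = {v :: real ^ 'n. (\<forall>i. 0 \<le> v $ i) \<and> (\<Sum>i\<in>UNIV. v $ i) = 1}"
  have c_pos: "c v j > 0" if v: "\<forall>i. 0 \<le> v $ i" "v \<noteq> 0" for v j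
  proof -
    obtain i where "v $ i \<noteq> 0" using v(2) by (auto simp: vec_eq_iff)
    then have "A $ i $ j * v $ i > 0"
      using v(1) A by (simp add: pos_mat_def less_le)
    then show ?thesis
      unfolding c_def using v(1) A
      by (intro sum_pos2[of _ i]) (auto simp: pos_mat_def less_imp_le)
  qed
  have K: "\<forall>i. 0 \<le> v $ i" "v \<noteq> 0" if "v \<in> K" for v
    using that by (auto simp: K_def)
  have "norm v \<le> 1" if "v \<in> K" for v
    using norm_le_l1_cart[of v] that by (simp add: K_def)
  then have "bounded K"
    by (auto simp: bounded_iff)
  moreover have "closed K"
    unfolding K_def by (intro closed_Collect_conj closed_Collect_all closed_Collect_le closed_Collect_eq continuous_intros)
  ultimately have "compact K"
    by (simp add: compact_eq_bounded_closed)
  moreover have "(\<chi> i. 1 / real CARD('n)) \<in> K"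
    by (simp add: K_def)
  moreover have "continuous_on K G"
    unfolding G_def c_def using c_pos[OF K] unfolding c_def
    by (intro continuous_intros) (auto simp: less_imp_neq[symmetric])
  ultimately obtain v where v: "v \<in> K" "\<And>w. w \<in> K \<Longrightarrow> G w \<le> G v"
    using continuous_attains_sup[of K G] by blast
  have G_homog: "G (r *\<^sub>R w) = G w" if "r > 0" for r w
    using that unfolding G_def c_def
    by (simp add: prod.distrib sum_distrib_left[symmetric] mult.left_commute)
  have G_le: "G w \<le> G v" if "\<forall>i. 0 < w $ i" for w
  proof -
    have s: "(\<Sum>i\<in>UNIV. w $ i) > 0" using that by (intro sum_pos) auto
    have "(1 / (\<Sum>i\<in>UNIV. w $ i)) *\<^sub>R w \<in> K"
      using that s by (auto simp: K_def sum_divide_distrib[symmetric] less_imp_le)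
    then show ?thesis using v(2) G_homog s by (metis divide_pos_pos zero_less_one)
  qed
  have G_pos: "G w > 0" if "\<forall>i. 0 < w $ i" for w
  proof -
    have "w \<noteq> 0" using that by force
    then show ?thesis
    unfolding G_def using that c_pos by (intro divide_pos_pos prod_pos) (auto simp: less_imp_le)
  qed
  have "G v > 0"
    using G_pos[of "\<chi> i. 1"] G_le[of "\<chi> i. 1"] by simp
  then have v_pos: "v $ i > 0" for i
    using K[OF v(1)] by (metis G_def div_0 finite less_irrefl order_le_less prod_zero_iff UNIV_I)
  have cv: "c v j > 0" for j using c_pos K v(1) by blast
  \<comment> \<open>At the maximiser the derivative of \<open>ln (G v)\<close> in the
    \<open>i\<close>-th coordinate direction vanishes. This says that row \<open>i\<close> of the
    scaled matrix sums to 1; the columns do so by the definition of \<open>c\<close>.\<close>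
  have stationary: "(\<Sum>j\<in>UNIV. A $ i $ j / c v j) = 1 / v $ i" for i
  proof -
    define \<delta> :: "'n \<Rightarrow> real" where "\<delta> k = (if k = i then 1 else 0)" for k
    define \<phi> where "\<phi> t = (\<Sum>k\<in>UNIV. ln (v $ k + t * \<delta> k))
        - (\<Sum>j\<in>UNIV. ln (c v j + t * A $ i $ j))" for t
    \<comment> \<open>The bound on \<open>t\<close> keeps all coordinates of
      \<open>v + t *\<^sub>R axis i 1\<close> positive, and there \<open>\<phi> t\<close> is the
      logarithm of \<open>G\<close>.\<close>
    have le: "\<phi> t \<le> \<phi> 0" if t: "\<bar>0 - t\<bar> < v $ i" for t
    proof -
      define w where "w = v + t *\<^sub>R axis i 1"
      have w: "w $ k = v $ k + t * \<delta> k" for k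
        by (simp add: w_def axis_def \<delta>_def)
      have w_pos: "\<forall>k. w $ k > 0" using t v_pos by (auto simp: w \<delta>_def)
      have cw: "c w j = c v j + t * A $ i $ j" for j
      proof -
        have "A $ k $ j * w $ k = A $ k $ j * v $ k + (if k = i then t * A $ i $ j else 0)" for k
          by (simp add: w \<delta>_def algebra_simps)
        then show ?thesis by (simp add: c_def sum.distrib)
      qed
      have "w \<noteq> 0" using w_pos by force
      then have cw_pos: "c w j > 0" for j using c_pos w_pos less_imp_le by blast
      have "\<phi> t = ln (G w)"
        unfolding \<phi>_def w[symmetric] cw[symmetric] G_def using w_pos cw_pos
        by (simp add: ln_div prod_pos ln_prod less_imp_neq[symmetric])
      moreover have "\<phi> 0 = ln (G v)"
        unfolding \<phi>_def G_def using v_pos cv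
        by (simp add: ln_div prod_pos ln_prod less_imp_neq[symmetric])
      ultimately show ?thesis
        using G_le[OF w_pos] G_pos[OF w_pos] by (simp add: ln_mono)
    qed
    have "(\<phi> has_real_derivative (\<Sum>k\<in>UNIV. \<delta> k / v $ k)
        - (\<Sum>j\<in>UNIV. A $ i $ j / c v j)) (at 0)"
      unfolding \<phi>_def by (auto intro!: derivative_eq_intros simp: v_pos cv)
    then have "(\<Sum>k\<in>UNIV. \<delta> k / v $ k) - (\<Sum>j\<in>UNIV. A $ i $ j / c v j) = 0"
      using le v_pos DERIV_local_max by blast
    moreover have "(\<Sum>k\<in>UNIV. \<delta> k / v $ k) = (\<Sum>k\<in>UNIV. if k = i then 1 / v $ i else 0)"
      by (intro sum.cong) (auto simp: \<delta>_def)
    ultimately show ?thesis by simp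
  qed
  define S where "S = (\<chi> i j. v $ i * A $ i $ j * (1 / c v j))"
  have "doubly_stochastic S"
    unfolding doubly_stochastic_def
  proof (intro conjI allI)
    fix i j
    show "0 \<le> S $ i $ j"
      using v_pos[of i] cv[of j] A by (simp add: S_def pos_mat_def less_imp_le)
    show "(\<Sum>j\<in>UNIV. S $ i $ j) = 1"
    proof -
      have "(\<Sum>j\<in>UNIV. S $ i $ j) = v $ i * (\<Sum>j\<in>UNIV. A $ i $ j / c v j)"
        by (simp add: S_def sum_distrib_left)
      then show ?thesis using stationary[of i] v_pos[of i] by simp
    qed
    show "(\<Sum>i\<in>UNIV. S $ i $ j) = 1"
    proof -
      have "(\<Sum>i\<in>UNIV. S $ i $ j) = c v j / c v j"
        unfolding c_def[of v j] sum_divide_distrib by (simp add: S_def c_def mult.commute)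
      then show ?thesis using cv[of j] by simp
    qed
  qed
  then have "sinkhorn_scaling A S"
    by (rule sinkhorn_scalingI[of _ "\<lambda>i. v $ i" "\<lambda>j. 1 / c v j"]) (simp_all add: S_def v_pos cv)
  then show ?thesis ..
qed

lemma sinkhorn_eqI:
  fixes A S :: "real ^ 'n ^ 'n"
  assumes "pos_mat A" "sinkhorn_scaling A S"
  shows "sinkhorn A = S"
proof -
  have "sinkhorn A = (THE S. sinkhorn_scaling A S)"
    unfolding sinkhorn_def sinkhorn_scaling_def by simp
  also have "\<dots> = S"
  proof (rule the_equality)
    show "T = S" if "sinkhorn_scaling A T" for T
      using sinkhorn_scaling_dist_le[OF assms assms(1) that] by simp
  qed (fact assms(2))
  finally show ?thesis .
qed

lemma sinkhorn_scaling_sinkhorn: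
  fixes A :: "real ^ 'n ^ 'n"
  shows "pos_mat A \<Longrightarrow> sinkhorn_scaling A (sinkhorn A)"
  using sinkhorn_scaling_exists[of A] sinkhorn_eqI[of A] by auto

lemma sinkhorn_pos_mat: "pos_mat A \<Longrightarrow> pos_mat (sinkhorn A)"
  using sinkhorn_scaling_sinkhorn sinkhorn_scaling_pos_mat by blast

lemma sinkhorn_doubly_stochastic: "pos_mat A \<Longrightarrow> doubly_stochastic (sinkhorn A)"
  using sinkhorn_scaling_sinkhorn sinkhorn_scaling_doubly_stochastic by blast

section \<open>Entropy and Gibbs' inequality\<close>

lemma mat_entropy_eq_inner: "mat_entropy S = - (S \<bullet> log_mat S) / ln 2"
  by (simp add: mat_entropy_def inner_mat log_mat_def log_def sum_divide_distrib)

text \<open>Strict convexity of \<open>x * ln x\<close>: the gap between the function at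
  \<open>t\<close> and its tangent at \<open>s\<close> is
  \<open>t * (s / t - 1 - ln (s / t))\<close>, which is nonnegative and vanishes only for
  \<open>s = t\<close>.\<close>

lemma mult_ln_tangent:
  fixes s t :: real
  assumes "0 < s" "0 < t"
  shows "s * ln s + (ln s + 1) * (t - s) \<le> t * ln t"
    and "s * ln s + (ln s + 1) * (t - s) = t * ln t \<longleftrightarrow> s = t"
proof -
  have eq: "t * ln t - (s * ln s + (ln s + 1) * (t - s)) = t * (s / t - 1 - ln (s / t))"
    using assms by (simp add: ln_div algebra_simps)
  have "0 \<le> s / t - 1 - ln (s / t)"
    using assms ln_le_minus_one[of "s / t"] by simp
  then show "s * ln s + (ln s + 1) * (t - s) \<le> t * ln t"
    using eq assms(2) by (metis diff_ge_0_iff_ge less_imp_le zero_le_mult_iff)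
  have "s / t = 1" if "ln (s / t) = s / t - 1"
    using that assms by (intro ln_eq_minus_one) auto
  then show "s * ln s + (ln s + 1) * (t - s) = t * ln t \<longleftrightarrow> s = t"
    using eq assms by auto
qed

text \<open>Sum of the tangent inequalities over all entries. The summand 1 in the slope
  \<open>ln s + 1\<close> cancels because both matrices have the same total. The left side equals
  \<open>T \<bullet> log_mat S\<close>; it is split so that the orthogonality relation applies to
  \<open>T - S\<close>.\<close>

lemma gibbs_inequality:
  fixes S T :: "real ^ 'n ^ 'n"
  assumes S: "pos_mat S" "doubly_stochastic S" and T: "pos_mat T" "doubly_stochastic T"
  shows "S \<bullet> log_mat S + (T - S) \<bullet> log_mat S \<le> T \<bullet> log_mat T"
    and "S \<bullet> log_mat S + (T - S) \<bullet> log_mat S = T \<bullet> log_mat T \<Longrightarrow> S = T"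
proof -
  define g where "g i j = T $ i $ j * ln (T $ i $ j) -
    (S $ i $ j * ln (S $ i $ j) + (ln (S $ i $ j) + 1) * (T $ i $ j - S $ i $ j))" for i j
  have pos: "S $ i $ j > 0" "T $ i $ j > 0" for i j
    using assms by (auto simp: pos_mat_def)
  have g: "g i j \<ge> 0" "g i j = 0 \<longleftrightarrow> S $ i $ j = T $ i $ j" for i j
    using mult_ln_tangent[OF pos, of i j i j] by (auto simp: g_def)
  have "(\<Sum>i\<in>UNIV. \<Sum>j\<in>UNIV. g i j) = T \<bullet> log_mat T - (S \<bullet> log_mat S + (T - S) \<bullet> log_mat S)
     - ((\<Sum>i\<in>UNIV. \<Sum>j\<in>UNIV. T $ i $ j) - (\<Sum>i\<in>UNIV. \<Sum>j\<in>UNIV. S $ i $ j))"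
    by (simp add: g_def inner_mat log_mat_def sum_subtractf sum.distrib algebra_simps)
  then have sum_g: "(\<Sum>i\<in>UNIV. \<Sum>j\<in>UNIV. g i j)
      = T \<bullet> log_mat T - (S \<bullet> log_mat S + (T - S) \<bullet> log_mat S)"
    using S T by (simp add: doubly_stochastic_sum)
  show "S \<bullet> log_mat S + (T - S) \<bullet> log_mat S \<le> T \<bullet> log_mat T"
    using sum_g g(1) by (metis diff_ge_0_iff_ge sum_nonneg)
  assume "S \<bullet> log_mat S + (T - S) \<bullet> log_mat S = T \<bullet> log_mat T"
  then have "(\<Sum>i\<in>UNIV. \<Sum>j\<in>UNIV. g i j) = 0" using sum_g by simp
  then have "g i j = 0" for i j
    using g(1) by (simp add: sum_nonneg_eq_0_iff sum_nonneg)
  then show "S = T" using g(2) by (simp add: vec_eq_iff)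
qed

text \<open>The unique entropy maximiser among positive doubly stochastic matrices, and the scaling
  of every consistent matrix.\<close>

definition uniform_mat :: "real ^ 'n ^ 'n" where
  "uniform_mat = (\<chi> i j. 1 / real CARD('n))"

lemma uniform_mat: "pos_mat uniform_mat" "doubly_stochastic uniform_mat"
  by (simp_all add: uniform_mat_def pos_mat_def doubly_stochastic_def)

lemma inner_log_uniform_mat:
  fixes S :: "real ^ 'n ^ 'n"
  assumes "doubly_stochastic S"
  shows "S \<bullet> log_mat uniform_mat = - (real CARD('n) * ln (real CARD('n)))"
  using doubly_stochastic_sum[OF assms]
  by (simp add: inner_mat log_mat_def uniform_mat_def ln_div sum_distrib_right[symmetric]
      sum_negf)

text \<open>The factors \<open>ln 2\<close> of the entropy and of the normaliser cancel.\<close>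

lemma I_H_eq_inner:
  fixes A :: "real ^ 'n ^ 'n"
  shows "I_H A = 1 + sinkhorn A \<bullet> log_mat (sinkhorn A) / (real CARD('n) * ln (real CARD('n)))"
  by (simp add: I_H_def mat_entropy_eq_inner log_def)

text \<open>Gibbs' inequality at the uniform matrix, whose logarithm has the same inner product
  \<open>- N\<close> with every doubly stochastic matrix; its equality case settles when the index
  vanishes.\<close>

lemma I_H_nonneg_eq_0_iff:
  fixes A :: "real ^ 'n ^ 'n"
  assumes n: "CARD('n) \<ge> 2" and A: "pos_mat A"
  shows "0 \<le> I_H A" and "I_H A = 0 \<longleftrightarrow> sinkhorn A = uniform_mat"
proof -
  let ?S = "sinkhorn A"
  define N where "N = real CARD('n) * ln (real CARD('n))"
  have N: "N > 0" unfolding N_def using n by (intro mult_pos_pos) auto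
  have I: "I_H A = (N + ?S \<bullet> log_mat ?S) / N"
    using N by (simp add: I_H_eq_inner N_def[symmetric] add_divide_distrib)
  have S: "pos_mat ?S" "doubly_stochastic ?S"
    using A by (simp_all add: sinkhorn_pos_mat sinkhorn_doubly_stochastic)
  note gibbs = gibbs_inequality[OF uniform_mat S]
  have "- N \<le> ?S \<bullet> log_mat ?S"
    using gibbs(1) by (simp add: inner_diff_left inner_log_uniform_mat N_def S uniform_mat)
  then show "0 \<le> I_H A"
    using N by (simp add: I)
  have "I_H A = 0 \<longleftrightarrow> ?S \<bullet> log_mat ?S = - N"
    using N by (auto simp: I)
  also have "\<dots> \<longleftrightarrow> ?S = uniform_mat"
    using gibbs(2) by (auto simp: inner_diff_left inner_log_uniform_mat N_def S uniform_mat)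
  finally show "I_H A = 0 \<longleftrightarrow> ?S = uniform_mat" .
qed

section \<open>Null inconsistency\<close>

lemma pcms_pos_mat: "A \<in> pcms \<Longrightarrow> pos_mat A"
  unfolding pcms_def pos_mat_def by blast

text \<open>A weight vector \<open>w\<close> yields the scaling factors \<open>1 / w $ i\<close> and
  \<open>w $ j / n\<close>. Conversely, the left factors \<open>d\<close> of a uniform scaling yield
  the weights \<open>1 / d i\<close>.\<close>

lemma consistent_iff_sinkhorn_uniform:
  fixes A :: "real ^ 'n ^ 'n"
  assumes "A \<in> pcms"
  shows "A \<in> consistent_pcms \<longleftrightarrow> sinkhorn A = uniform_mat"
proof
  assume "A \<in> consistent_pcms"
  then obtain w where w: "\<And>i. w $ i > 0" "\<And>i j. A $ i $ j = w $ i / w $ j"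
    unfolding consistent_pcms_def by blast
  have "w $ i \<noteq> 0" for i using w(1)[of i] by simp
  then have "sinkhorn_scaling A uniform_mat"
    using uniform_mat(2) w
    by (intro sinkhorn_scalingI[of _ "\<lambda>i. 1 / w $ i" "\<lambda>j. w $ j / real CARD('n)"])
      (auto simp: uniform_mat_def)
  then show "sinkhorn A = uniform_mat"
    using sinkhorn_eqI pcms_pos_mat assms by blast
next
  assume "sinkhorn A = uniform_mat"
  then have scal: "sinkhorn_scaling A uniform_mat"
    using sinkhorn_scaling_sinkhorn[OF pcms_pos_mat[OF assms]] by simp
  obtain d e where de: "\<And>i. d i > 0" "\<And>j. e j > 0"
      "\<And>i j. (uniform_mat :: real ^ 'n ^ 'n) $ i $ j = d i * A $ i $ j * e j"
    using sinkhorn_scalingD[OF scal] by blast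
  have ne: "d i \<noteq> 0" "e i \<noteq> 0" for i using de(1,2)[of i] by auto
  have A1: "A $ i $ i = 1" for i using assms unfolding pcms_def by blast
  \<comment> \<open>Entries \<open>(j, j)\<close> and \<open>(i, j)\<close> of the uniform matrix
    agree and the diagonal of \<open>A\<close> is 1, so the right factor \<open>e j\<close>
    cancels.\<close>
  have "d j * e j = d i * A $ i $ j * e j" for i j
    using de(3)[of j j] de(3)[of i j] by (simp add: A1 uniform_mat_def)
  then have "A $ i $ j = (1 / d i) / (1 / d j)" for i j
    using ne by (simp add: field_simps)
  then show "A \<in> consistent_pcms"
    unfolding consistent_pcms_def using assms de(1)
    by (auto intro!: exI[of _ "\<chi> i. 1 / d i"])
qed

lemma I_H_eq_0_iff:
  fixes A :: "real ^ 'n ^ 'n"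
  assumes "CARD('n) \<ge> 2" "A \<in> pcms"
  shows "I_H A = 0 \<longleftrightarrow> A \<in> consistent_pcms"
  using assms by (simp add: I_H_nonneg_eq_0_iff pcms_pos_mat consistent_iff_sinkhorn_uniform)

section \<open>Invariance under scaling, transposition and permutation\<close>

text \<open>Dividing the factors \<open>d\<close> and \<open>e\<close> out shows that
  \<open>B\<close> has the same scaling as \<open>A\<close>. This serves diagonal similarity and the
  reduction of a perturbed consistent matrix to a perturbed all-ones matrix.\<close>

lemma I_H_scale:
  fixes A B :: "real ^ 'n ^ 'n"
  assumes A: "pos_mat A" and d: "\<And>i. d i > 0" "\<And>i. e i > 0"
    and B: "\<And>i j. B $ i $ j = d i * A $ i $ j * e j"
  shows "I_H B = I_H A"
proof -
  obtain x y where xy: "\<And>i. x i > 0" "\<And>j. y j > 0"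
      "\<And>i j. sinkhorn A $ i $ j = x i * A $ i $ j * y j"
    using sinkhorn_scalingD[OF sinkhorn_scaling_sinkhorn[OF A]] by blast
  have ne: "d i \<noteq> 0" "e i \<noteq> 0" for i using d[of i] by auto
  have "sinkhorn_scaling B (sinkhorn A)"
    using sinkhorn_doubly_stochastic[OF A] d xy ne
    by (intro sinkhorn_scalingI[of _ "\<lambda>i. x i / d i" "\<lambda>j. y j / e j"]) (auto simp: B)
  moreover have "pos_mat B" using A d by (simp add: pos_mat_def B)
  ultimately show ?thesis by (simp add: I_H_def sinkhorn_eqI)
qed

text \<open>Transposing the scaling exchanges its left and right factors and leaves the multiset of
  entries unchanged.\<close>

lemma I_H_transpose:
  fixes A :: "real ^ 'n ^ 'n"
  assumes A: "pos_mat A"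
  shows "I_H (transpose A) = I_H A"
proof -
  obtain x y where xy: "\<And>i. x i > 0" "\<And>j. y j > 0"
      "\<And>i j. sinkhorn A $ i $ j = x i * A $ i $ j * y j"
    using sinkhorn_scalingD[OF sinkhorn_scaling_sinkhorn[OF A]] by blast
  have "sinkhorn_scaling (transpose A) (transpose (sinkhorn A))"
    using sinkhorn_doubly_stochastic[OF A] xy
    by (intro sinkhorn_scalingI[of _ y x]) (auto simp: transpose_def doubly_stochastic_def)
  moreover have "pos_mat (transpose A)" using A by (simp add: pos_mat_def transpose_def)
  moreover have "mat_entropy (transpose S) = mat_entropy S" for S :: "real ^ 'n ^ 'n"
    unfolding mat_entropy_def by (subst sum.swap) (simp add: transpose_def)
  ultimately show ?thesis by (simp add: I_H_def sinkhorn_eqI)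
qed

lemma I_H_permute:
  fixes A B :: "real ^ 'n ^ 'n"
  assumes A: "pos_mat A" and \<sigma>: "bij \<sigma>" and B: "\<And>i j. B $ i $ j = A $ \<sigma> i $ \<sigma> j"
  shows "I_H B = I_H A"
proof -
  obtain x y where xy: "\<And>i. x i > 0" "\<And>j. y j > 0"
      "\<And>i j. sinkhorn A $ i $ j = x i * A $ i $ j * y j"
    using sinkhorn_scalingD[OF sinkhorn_scaling_sinkhorn[OF A]] by blast
  define S where "S = (\<chi> i j. sinkhorn A $ \<sigma> i $ \<sigma> j)"
  note reindex = sum.reindex_bij_betw[OF \<sigma>]
  have "doubly_stochastic S"
    using sinkhorn_doubly_stochastic[OF A]
    by (simp add: doubly_stochastic_def S_def reindex[of "\<lambda>j. _ $ j"] reindex[of "\<lambda>j. _ $ j $ _"])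
  then have "sinkhorn_scaling B S"
    using xy by (intro sinkhorn_scalingI[of _ "\<lambda>i. x (\<sigma> i)" "\<lambda>i. y (\<sigma> i)"]) (auto simp: B S_def)
  moreover have "pos_mat B" using A by (simp add: pos_mat_def B)
  moreover have "mat_entropy S = mat_entropy (sinkhorn A)"
    by (simp add: mat_entropy_def S_def reindex[of "\<lambda>j. _ $ j * log 2 (_ $ j)"]
        reindex[of "\<lambda>i. \<Sum>j\<in>UNIV. _ $ i $ j * log 2 (_ $ i $ j)"])
  ultimately show ?thesis by (simp add: I_H_def sinkhorn_eqI)
qed

section \<open>Monotonicity under entrywise powers\<close>

lemma I_H_powr_mono:
  fixes A :: "real ^ 'n ^ 'n"
  assumes n: "CARD('n) \<ge> 2" and A: "pos_mat A" and b: "0 < b1" "b1 < b2"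
  shows "I_H (entrywise_powr A b1) \<le> I_H (entrywise_powr A b2)"
proof -
  have ne: "A $ i $ j \<noteq> 0" for i j
    using A by (metis pos_mat_def less_irrefl)
  have pos: "pos_mat (entrywise_powr A b)" for b
    using ne by (simp add: pos_mat_def entrywise_powr_def)
  have log: "log_mat (entrywise_powr A b) = b *\<^sub>R log_mat A" for b
    using A by (simp add: vec_eq_iff log_mat_def entrywise_powr_def ln_powr ne)
  define S1 where "S1 = sinkhorn (entrywise_powr A b1)"
  define S2 where "S2 = sinkhorn (entrywise_powr A b2)"
  have scal: "sinkhorn_scaling (entrywise_powr A b1) S1" "sinkhorn_scaling (entrywise_powr A b2) S2"
    by (simp_all add: S1_def S2_def sinkhorn_scaling_sinkhorn pos)
  have S: "pos_mat S1" "doubly_stochastic S1" "pos_mat S2" "doubly_stochastic S2"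
    by (simp_all add: S1_def S2_def sinkhorn_pos_mat sinkhorn_doubly_stochastic pos)
  have d1: "(T - T') \<bullet> log_mat S1 = b1 * ((T - T') \<bullet> log_mat A)"
    and d2: "(T - T') \<bullet> log_mat S2 = b2 * ((T - T') \<bullet> log_mat A)"
    if "doubly_stochastic T" "doubly_stochastic T'" for T T'
    using doubly_stochastic_diff_inner_log[OF pos scal(1) that]
      doubly_stochastic_diff_inner_log[OF pos scal(2) that] by (simp_all add: log)
  let ?x = "(S2 - S1) \<bullet> log_mat A"
  \<comment> \<open>Gibbs' inequality is used twice, with the tangent first at \<open>S1\<close> and
    then at \<open>S2\<close>. In the sum of the two estimates the entropies cancel, and
    \<open>b1 < b2\<close> forces \<open>?x \<ge> 0\<close>; the first estimate then gives the
    claim.\<close>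
  have 1: "S1 \<bullet> log_mat S1 + b1 * ?x \<le> S2 \<bullet> log_mat S2"
    using gibbs_inequality(1)[OF S] by (simp add: d1 S)
  have "S2 \<bullet> log_mat S2 - b2 * ?x \<le> S1 \<bullet> log_mat S1"
    using gibbs_inequality(1)[OF S(3,4,1,2)] d2[OF S(2,4)] by (simp add: inner_diff_left algebra_simps)
  then have "0 \<le> (b2 - b1) * ?x" using 1 by (simp add: algebra_simps)
  then have "0 \<le> b1 * ?x" using b by (simp add: zero_le_mult_iff)
  then have "S1 \<bullet> log_mat S1 \<le> S2 \<bullet> log_mat S2" using 1 by linarith
  then show ?thesis
    using n by (simp add: I_H_eq_inner S1_def S2_def divide_right_mono)
qed

section \<open>Continuity\<close>

lemma continuous_on_log_mat: "continuous_on {A. pos_mat A} log_mat"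
  unfolding log_mat_def pos_mat_def
  by (intro continuous_intros) (auto simp: less_imp_neq[symmetric])

text \<open>The scaling is 1-Lipschitz as a function of the entrywise logarithm.\<close>

lemma continuous_on_sinkhorn: "continuous_on {A. pos_mat A} sinkhorn"
  unfolding continuous_on_iff
proof (intro ballI allI impI)
  fix A :: "real ^ 'n ^ 'n" and \<epsilon> :: real
  assume A: "A \<in> {A. pos_mat A}" and "\<epsilon> > 0"
  then obtain r where r: "r > 0"
      "\<And>B. pos_mat B \<Longrightarrow> dist B A < r \<Longrightarrow> dist (log_mat B) (log_mat A) < \<epsilon>"
    using continuous_on_log_mat unfolding continuous_on_iff by (metis mem_Collect_eq)
  have "dist (sinkhorn B) (sinkhorn A) \<le> dist (log_mat B) (log_mat A)" if "pos_mat B" for B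
    using sinkhorn_scaling_dist_le[of A "sinkhorn A" B "sinkhorn B"] that A
    by (simp add: sinkhorn_scaling_sinkhorn dist_norm)
  with r show "\<exists>r>0. \<forall>B\<in>{A. pos_mat A}. dist B A < r \<longrightarrow> dist (sinkhorn B) (sinkhorn A) < \<epsilon>"
    by (metis le_less_trans mem_Collect_eq)
qed

lemma continuous_on_I_H:
  assumes "CARD('n::finite) \<ge> 2"
  shows "continuous_on {A :: real ^ 'n ^ 'n. pos_mat A} I_H"
proof -
  have "continuous_on {A :: real ^ 'n ^ 'n. pos_mat A} (\<lambda>A. log_mat (sinkhorn A))"
    using sinkhorn_pos_mat
    by (intro continuous_on_compose2[OF continuous_on_log_mat continuous_on_sinkhorn]) auto
  then have "continuous_on {A :: real ^ 'n ^ 'n. pos_mat A}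
      (\<lambda>A. 1 + sinkhorn A \<bullet> log_mat (sinkhorn A) / (real CARD('n) * ln (real CARD('n))))"
    using assms by (intro continuous_intros continuous_on_sinkhorn) auto
  then show ?thesis
    by (rule continuous_on_eq) (simp add: I_H_eq_inner)
qed

section \<open>Perturbation of a single comparison\<close>

lemma quasi_convex_on_inversion_symmetric:
  fixes f :: "real \<Rightarrow> real"
  assumes mono: "\<And>x y. 1 \<le> x \<Longrightarrow> x \<le> y \<Longrightarrow> f x \<le> f y"
    and inv: "\<And>x. 0 < x \<Longrightarrow> f (1 / x) = f x"
  shows "quasi_convex_on {0<..} f"
  unfolding quasi_convex_on_def
proof (intro conjI ballI allI impI)
  fix x y u v :: real
  assume xy: "x \<in> {0<..}" "y \<in> {0<..}" and uv: "0 \<le> u" "0 \<le> v" "u + v = 1"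
  \<comment> \<open>A point \<open>z \<ge> 1\<close> is compared with the right endpoint. For
    \<open>z < 1\<close>, inversion turns \<open>x \<le> z\<close> into
    \<open>1 / z \<le> 1 / x\<close> beyond 1, so \<open>z\<close> is compared with the left
    endpoint.\<close>
  have between: "f z \<le> max (f x) (f y)" if "0 < x" "x \<le> z" "z \<le> y" for x y z
  proof (cases "1 \<le> z")
    case True
    then show ?thesis using mono[of z y] that by (simp add: le_max_iff_disj)
  next
    case False
    then have "f (1 / z) \<le> f (1 / x)"
      using that by (intro mono) (auto simp: frac_le)
    then show ?thesis using that by (simp add: inv le_max_iff_disj)
  qed
  have "u *\<^sub>R x + v *\<^sub>R y \<in> closed_segment x y"
    using uv by (auto simp: closed_segment_def intro!: exI[of _ v])
  then show "f (u *\<^sub>R x + v *\<^sub>R y) \<le> max (f x) (f y)"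
    using between[of x _ y] between[of y _ x] xy
    by (auto simp: closed_segment_eq_real_ivl max.commute split: if_splits)
qed simp

lemma consistent_triple:
  "A \<in> consistent_pcms \<Longrightarrow> A $ i $ j * A $ j $ k = A $ i $ k"
  by (auto simp: consistent_pcms_def) (metis less_irrefl nonzero_mult_div_cancel_left times_divide_eq_left times_divide_times_eq mult.commute)

lemma perturb_pcms:
  assumes A: "A \<in> pcms" and pq: "p \<noteq> q" and \<delta>: "\<delta> > 0"
  shows "perturb A p q \<delta> \<in> pcms"
proof -
  have A: "A $ i $ j > 0" "A $ i $ i = 1" "A $ i $ j = 1 / A $ j $ i" for i j
    using A unfolding pcms_def by blast+
  have "perturb A p q \<delta> $ i $ j = 1 / perturb A p q \<delta> $ j $ i" for i j
    using A(3)[of i j] A(3)[of p q] A(1)[of q p] pq by (auto simp: perturb_def inverse_eq_divide)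
  moreover have "perturb A p q \<delta> $ i $ j > 0" "perturb A p q \<delta> $ i $ i = 1" for i j
    using A(1,2) pq \<delta> by (auto simp: perturb_def)
  ultimately show ?thesis unfolding pcms_def by blast
qed

text \<open>With a third index \<open>r\<close>, the entries \<open>(p, r)\<close> and
  \<open>(r, q)\<close> are untouched. Consistency determines entry \<open>(p, q)\<close> from them,
  so it could not have changed.\<close>

lemma perturb_inconsistent:
  fixes A :: "real ^ 'n ^ 'n"
  assumes n: "CARD('n) \<ge> 3" and A: "A \<in> consistent_pcms" and pq: "p \<noteq> q" and \<delta>: "\<delta> \<noteq> 1"
  shows "perturb A p q \<delta> \<notin> consistent_pcms"
proof
  assume B: "perturb A p q \<delta> \<in> consistent_pcms"
  have "card {p, q} \<noteq> CARD('n)" using n pq by simp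
  then have "{p, q} \<noteq> UNIV" by metis
  then obtain r where r: "r \<noteq> p" "r \<noteq> q"
    by blast
  have "A \<in> pcms" using A by (simp add: consistent_pcms_def)
  then have "A $ p $ q > 0" using pcms_pos_mat unfolding pos_mat_def by blast
  moreover have "\<delta> * A $ p $ q = A $ p $ q"
    using consistent_triple[OF B, of p r q] consistent_triple[OF A, of p r q] r pq
    by (simp add: perturb_def)
  ultimately show False using \<delta> by simp
qed

text \<open>Conjugation by the diagonal matrix of the weights carries the perturbed all-ones matrix
  to the perturbed \<open>A\<close>.\<close>

lemma I_H_perturb_consistent:
  fixes A :: "real ^ 'n ^ 'n"
  assumes A: "A \<in> consistent_pcms" and pq: "p \<noteq> q" and \<delta>: "\<delta> > 0"
  shows "I_H (perturb A p q \<delta>) = I_H (perturb (\<chi> i j. 1) p q \<delta>)"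
proof -
  obtain w where w: "\<And>i. w $ i > 0" "\<And>i j. A $ i $ j = w $ i / w $ j"
    using A unfolding consistent_pcms_def by blast
  show ?thesis
    using w(1) \<delta> by (intro I_H_scale[of _ "\<lambda>i. w $ i" "\<lambda>i. 1 / w $ i"])
      (auto simp: perturb_def w(2) pos_mat_def)
qed

lemma I_H_perturb_ones_inverse:
  assumes "p \<noteq> q" "\<delta> > 0"
  shows "I_H (perturb (\<chi> i j. 1) p q (1 / \<delta>)) = I_H (perturb (\<chi> i j. 1) p q \<delta>)"
proof -
  have "perturb (\<chi> i j. 1) p q (1 / \<delta>) = transpose (perturb (\<chi> i j. 1) p q \<delta>)"
    using assms by (auto simp: perturb_def transpose_def vec_eq_iff field_simps)
  moreover have "pos_mat (perturb (\<chi> i j. 1) p q \<delta>)"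
    using assms by (simp add: perturb_def pos_mat_def)
  ultimately show ?thesis by (simp add: I_H_transpose)
qed

text \<open>The matrix for \<open>\<delta>'\<close> is the entrywise power of the one for
  \<open>\<delta>\<close> with exponent \<open>ln \<delta>' / ln \<delta>\<close>, which needs
  \<open>ln \<delta>\<close> nonzero; hence the strict bound \<open>1 < \<delta>\<close>.\<close>

lemma I_H_perturb_ones_mono:
  fixes p q :: "'n::finite"
  assumes n: "CARD('n) \<ge> 2" and pq: "p \<noteq> q" and \<delta>: "1 < \<delta>" "\<delta> \<le> \<delta>'"
  shows "I_H (perturb (\<chi> i j. 1) p q \<delta>) \<le> I_H (perturb (\<chi> i j. 1) p q \<delta>')"
proof (cases "\<delta> = \<delta>'")
  case False
  let ?P = "perturb (\<chi> i j. 1) p q"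
  have powr: "\<delta> powr (ln \<delta>' / ln \<delta>) = \<delta>'"
    using \<delta> by (simp add: powr_def)
  have "?P \<delta>' = entrywise_powr (?P \<delta>) (ln \<delta>' / ln \<delta>)"
    using \<delta> powr pq
    by (simp add: vec_eq_iff perturb_def entrywise_powr_def powr_minus[symmetric] inverse_powr)
  moreover have "?P \<delta> = entrywise_powr (?P \<delta>) 1"
    using \<delta> by (simp add: vec_eq_iff perturb_def entrywise_powr_def)
  moreover have "pos_mat (?P \<delta>)"
    using \<delta> by (simp add: perturb_def pos_mat_def)
  moreover have "1 < ln \<delta>' / ln \<delta>" using \<delta> False by simp
  ultimately show ?thesis
    using I_H_powr_mono[OF n, of "?P \<delta>" 1 "ln \<delta>' / ln \<delta>"] by simp
qed simp

lemma perturb_1: "perturb A p q 1 = A"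
  by (simp add: vec_eq_iff perturb_def)

lemma I_H_perturb_quasi_convex:
  fixes A :: "real ^ 'n ^ 'n"
  assumes n: "CARD('n) \<ge> 2" and A: "A \<in> consistent_pcms" and pq: "p \<noteq> q"
  shows "quasi_convex_on {0<..} (\<lambda>\<delta>. I_H (perturb A p q \<delta>))"
proof (rule quasi_convex_on_inversion_symmetric)
  have pcm: "A \<in> pcms" using A by (simp add: consistent_pcms_def)
  fix x y :: real
  show "I_H (perturb A p q x) \<le> I_H (perturb A p q y)" if "1 \<le> x" "x \<le> y"
  proof (cases "x = 1")
    case True
    then show ?thesis
      using I_H_eq_0_iff[OF n pcm] A I_H_nonneg_eq_0_iff(1)[OF n pcms_pos_mat]
        perturb_pcms[OF pcm pq, of y] that by (simp add: perturb_1)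
  next
    case False
    then show ?thesis
      using that by (simp add: I_H_perturb_consistent[OF A pq] I_H_perturb_ones_mono[OF n pq])
  qed
  show "I_H (perturb A p q (1 / x)) = I_H (perturb A p q x)" if "0 < x"
    using that by (simp add: I_H_perturb_consistent[OF A pq] I_H_perturb_ones_inverse[OF pq])
qed

lemma I_H_perturb_min:
  fixes A :: "real ^ 'n ^ 'n"
  assumes n: "CARD('n) \<ge> 3" and A: "A \<in> consistent_pcms" and pq: "p \<noteq> q"
    and \<delta>: "\<delta> > 0" "\<delta> \<noteq> 1"
  shows "I_H (perturb A p q 1) < I_H (perturb A p q \<delta>)"
proof -
  have n2: "CARD('n) \<ge> 2" using n by simp
  have pcm: "A \<in> pcms" using A by (simp add: consistent_pcms_def)
  note B = perturb_pcms[OF pcm pq \<delta>(1)]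
  show ?thesis
    using I_H_eq_0_iff[OF n2 pcm] A I_H_eq_0_iff[OF n2 B] perturb_inconsistent[OF n A pq \<delta>(2)]
      I_H_nonneg_eq_0_iff(1)[OF n2 pcms_pos_mat[OF B]] by (simp add: perturb_1 less_le)
qed

section \<open>Matrix conjugations and the combined statement\<close>

lemma permutation_matrix_conj_nth:
  fixes A :: "real ^ 'n ^ 'n"
  assumes "P = (\<chi> i j. if j = \<sigma> i then 1 else 0)"
  shows "(P ** A ** transpose P) $ i $ j = A $ \<sigma> i $ \<sigma> j"
  by (simp add: assms matrix_matrix_mult_def transpose_def if_distrib if_distribR cong: if_cong)

lemma matrix_inv_diag_mat:
  fixes d :: "real ^ 'n"
  assumes "\<And>i. d $ i > 0"
  shows "matrix_inv (diag_mat d) = diag_mat (\<chi> i. 1 / d $ i)"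
proof -
  let ?D = "diag_mat d" and ?E = "diag_mat (\<chi> i. 1 / d $ i)"
  have ne: "d $ i \<noteq> 0" for i using assms[of i] by simp
  have E: "?D ** ?E = mat 1" "?E ** ?D = mat 1"
    using ne by (simp_all add: vec_eq_iff diag_mat_mult_nth[where A = "mat 1", simplified] mat_def)
  \<comment> \<open>\<open>matrix_inv\<close> is a choice among two-sided inverses;
    \<open>?E\<close> witnesses that one exists, and multiplying by \<open>?E\<close> from the left
    identifies the chosen one.\<close>
  have "?D ** matrix_inv ?D = mat 1"
    unfolding matrix_inv_def using someI_ex[of "\<lambda>E. ?D ** E = mat 1 \<and> E ** ?D = mat 1"] E by blast
  then have "?E ** (?D ** matrix_inv ?D) = ?E" by simp
  then show ?thesis by (simp add: matrix_mul_assoc E)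
qed

theorem proposition4:
  assumes "CARD('n::finite) \<ge> 2"
  shows
    "(\<forall>A \<in> (pcms :: (real ^ 'n ^ 'n) set). I_H A = 0 \<longleftrightarrow> A \<in> consistent_pcms)
     \<and> (\<forall>A \<in> (pcms :: (real ^ 'n ^ 'n) set). \<forall>P. permutation_matrix P \<longrightarrow>
          I_H (P ** A ** transpose P) = I_H A)
     \<and> (\<forall>A \<in> (pcms :: (real ^ 'n ^ 'n) set). \<forall>b1 b2. b2 > b1 \<and> b1 > 0 \<longrightarrow>
          I_H (entrywise_powr A b2) \<ge> I_H (entrywise_powr A b1))
     \<and> (CARD('n) \<ge> 3 \<longrightarrow>
          (\<forall>A \<in> (consistent_pcms :: (real ^ 'n ^ 'n) set). \<forall>p q. p \<noteq> q \<longrightarrow>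
             quasi_convex_on {0<..} (\<lambda>\<delta>. I_H (perturb A p q \<delta>)) \<and>
             (\<forall>\<delta>>0. \<delta> \<noteq> 1 \<longrightarrow> I_H (perturb A p q 1) < I_H (perturb A p q \<delta>))))
     \<and> continuous_on (pcms :: (real ^ 'n ^ 'n) set) I_H
     \<and> (\<forall>A \<in> (pcms :: (real ^ 'n ^ 'n) set). I_H (transpose A) = I_H A)
     \<and> (\<forall>A \<in> (pcms :: (real ^ 'n ^ 'n) set). \<forall>d. (\<forall>i. d $ i > 0) \<longrightarrow>
          I_H (diag_mat d ** A ** matrix_inv (diag_mat d)) = I_H A)"
proof (intro conjI ballI allI impI; (elim conjE)?)
  fix A P :: "real ^ 'n ^ 'n"
  assume A: "A \<in> pcms"
  show "I_H A = 0 \<longleftrightarrow> A \<in> consistent_pcms"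
    using assms A by (rule I_H_eq_0_iff)
  show "I_H (P ** A ** transpose P) = I_H A" if P: "permutation_matrix P"
  proof -
    obtain \<sigma> where \<sigma>: "\<sigma> permutes UNIV" "P = (\<chi> i j. if j = \<sigma> i then 1 else 0)"
      using P unfolding permutation_matrix_def by blast
    then show ?thesis
      using pcms_pos_mat[OF A]
      by (intro I_H_permute[of _ \<sigma>] permutation_matrix_conj_nth permutes_bij)
  qed
  show "I_H (transpose A) = I_H A"
    using pcms_pos_mat[OF A] by (rule I_H_transpose)
  show "I_H (entrywise_powr A b1) \<le> I_H (entrywise_powr A b2)" if "b1 < b2" "0 < b1" for b1 b2
    using assms pcms_pos_mat[OF A] that by (intro I_H_powr_mono)
  show "I_H (diag_mat d ** A ** matrix_inv (diag_mat d)) = I_H A" if "\<forall>i. d $ i > 0"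
    for d :: "real ^ 'n"
    using that pcms_pos_mat[OF A]
    by (intro I_H_scale[of _ "\<lambda>i. d $ i" "\<lambda>i. 1 / d $ i"])
      (simp_all add: matrix_inv_diag_mat diag_mat_mult_nth)
next
  fix A :: "real ^ 'n ^ 'n" and p q :: 'n
  assume A: "3 \<le> CARD('n)" "A \<in> consistent_pcms" "p \<noteq> q"
  show "quasi_convex_on {0<..} (\<lambda>\<delta>. I_H (perturb A p q \<delta>))"
    using assms A(2,3) by (rule I_H_perturb_quasi_convex)
  show "I_H (perturb A p q 1) < I_H (perturb A p q \<delta>)" if "0 < \<delta>" "\<delta> \<noteq> 1" for \<delta>
    using A that by (rule I_H_perturb_min)
next
  show "continuous_on (pcms :: (real ^ 'n ^ 'n) set) I_H"
    using continuous_on_I_H[OF assms] by (rule continuous_on_subset) (auto simp: pcms_pos_mat)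
qed

end
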